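(* For every tiered auction instance (supplies $q_1,\dots,q_L$, bidders $1,\dots,n$ with tiers $\ell(i)$ and marginal valuations $u_i(j)$), the greedy allocation mechanism produces an allocation with optimal welfare: if $x_i^g$ is the number of items the greedy algorithm assigns to bidder $i$, then $(x_1^g,\dots,x_n^g)$ is a feasible allocation maximizing $\sum_{i=1}^n\sum_{k=1}^{x_i}u_i(k)$ over all feasible allocations $(x_1,\dots,x_n)$.
   Context: **Tiered instance.** There are tiers $1,\dots,L$ of items ($1$ lowest quality, $L$ highest). Tier $k$ contains $q_k$ identical items ($q_k$ a nonnegative integer), and $q=\sum_{k=1}^L q_k$. There are $n$ bidders. Bidder $i$ has a tier $\ell(i)\in\{1,\dots,L\}$, the lowest quality it accepts; it accepts items of any tier $\ge\ell(i)$ and is otherwise indifferent to quality. It has real marginal valuations $u_i(1)\ge u_i(2)\ge\dots\ge u_i(q)\ge 0$, where $u_i(j)$ is the value of its $j$-th acceptable item; we say the valuation $u_i(j)$ is in tier $\ell(i)$. Standing assumptions: the positive marginal valuations (over all pairs $(i,j)$) are pairwise distinct; and no submarket is undersubscribed, i.e. for every $t\in\{1,\dots,L\}$, $\#\{(i,j): \ell(i)\le t,\ u_i(j)>0\}\ \ge\ \sum_{k=1}^t q_k$. **Feasible allocation.** A vector $(x_1,\dots,x_n)$ of nonnegative integers with $\sum_{i:\ell(i)\ge t}x_i\le\sum_{k=t}^L q_k$ for all $t\in\{1,\dots,L\}$. **Greedy algorithm.** For $t=1,\dots,L$ in order: assign the $q_t$ items of tier $t$ to the $q_t$ highest valuations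 among all valuations in tiers $\le t$ that have not yet been assigned an item. The number $x_i^g$ of items assigned to bidder $i$ is the number of its valuations $u_i(\cdot)$ that are assigned an item. *)

theory Defs
  imports Complex_Main
begin

(* The tiers are 1, ..., L and the bidders 1, ..., n. Tier k has q k items, bidder i has tier
   l i, and u i j is the j-th marginal valuation of bidder i, for j = 1, ..., total_supply L q.
   Values of q, l, u and of allocations outside these ranges are irrelevant. *)

definition total_supply :: "nat \<Rightarrow> (nat \<Rightarrow> nat) \<Rightarrow> nat" where
  "total_supply t q = (\<Sum>k = 1..t. q k)"

(* A valuation is identified by its index pair (i, j), so equal (zero) values stay distinct. *)
definition valuations :: "nat \<Rightarrow> (nat \<Rightarrow> nat) \<Rightarrow> nat \<Rightarrow> (nat \<times> nat) set" where
  "valuations L q n = {1..n} \<times> {1..total_supply L q}"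

locale tiered_instance =
  fixes L :: nat
    and q :: "nat \<Rightarrow> nat"
    and n :: nat
    and l :: "nat \<Rightarrow> nat"
    and u :: "nat \<Rightarrow> nat \<Rightarrow> real"
  assumes tier: "i \<in> {1..n} \<Longrightarrow> l i \<in> {1..L}"
    and decreasing: "\<lbrakk>i \<in> {1..n}; 1 \<le> j; j \<le> k; k \<le> total_supply L q\<rbrakk> \<Longrightarrow> u i k \<le> u i j"
    and nonneg: "\<lbrakk>i \<in> {1..n}; j \<in> {1..total_supply L q}\<rbrakk> \<Longrightarrow> 0 \<le> u i j"
    and distinct_positive:
      "inj_on (\<lambda>(i, j). u i j) {(i, j) \<in> valuations L q n. u i j > 0}"
    and not_undersubscribed:
      "t \<in> {1..L} \<Longrightarrow>
        total_supply t q \<le> card {(i, j) \<in> valuations L q n. l i \<le> t \<and> u i j > 0}"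

definition feasible :: "nat \<Rightarrow> (nat \<Rightarrow> nat) \<Rightarrow> nat \<Rightarrow> (nat \<Rightarrow> nat) \<Rightarrow> (nat \<Rightarrow> nat) \<Rightarrow> bool" where
  "feasible L q n l x \<longleftrightarrow>
    (\<forall>t \<in> {1..L}. (\<Sum>i | i \<in> {1..n} \<and> l i \<ge> t. x i) \<le> (\<Sum>k = t..L. q k))"

definition welfare :: "nat \<Rightarrow> (nat \<Rightarrow> nat \<Rightarrow> real) \<Rightarrow> (nat \<Rightarrow> nat) \<Rightarrow> real" where
  "welfare n u x = (\<Sum>i = 1..n. \<Sum>k = 1..x i. u i k)"

(* The m elements of S with the highest values under f. In a tiered instance the choice made by
   the greedy algorithm exists and is unique: since no submarket is undersubscribed, at least q t
   unassigned valuations in tiers \<le> t are positive at step t, and these are pairwise distinct. *)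
definition highest :: "('a \<Rightarrow> real) \<Rightarrow> nat \<Rightarrow> 'a set \<Rightarrow> 'a set" where
  "highest f m S = (SOME A. A \<subseteq> S \<and> card A = m \<and> finite A \<and> (\<forall>a \<in> A. \<forall>b \<in> S - A. f b \<le> f a))"

(* The valuations that have been assigned an item after the steps for tiers 1, ..., t. *)
primrec greedy_assigned ::
  "nat \<Rightarrow> (nat \<Rightarrow> nat) \<Rightarrow> nat \<Rightarrow> (nat \<Rightarrow> nat) \<Rightarrow> (nat \<Rightarrow> nat \<Rightarrow> real) \<Rightarrow> nat \<Rightarrow> (nat \<times> nat) set" where
  "greedy_assigned L q n l u 0 = {}"
| "greedy_assigned L q n l u (Suc t) =
    greedy_assigned L q n l u t \<union>
    highest (\<lambda>(i, j). u i j) (q (Suc t))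
      ({(i, j) \<in> valuations L q n. l i \<le> Suc t} - greedy_assigned L q n l u t)"

definition greedy_allocation ::
  "nat \<Rightarrow> (nat \<Rightarrow> nat) \<Rightarrow> nat \<Rightarrow> (nat \<Rightarrow> nat) \<Rightarrow> (nat \<Rightarrow> nat \<Rightarrow> real) \<Rightarrow> nat \<Rightarrow> nat" where
  "greedy_allocation L q n l u i = card {j. (i, j) \<in> greedy_assigned L q n l u L}"

end

theory Submission
  imports Defs
begin

text \<open>
  Optimality is proved one threshold at a time: for every \<open>c > 0\<close> the greedy algorithm assigns at
  least as many valuations \<open>\<ge> c\<close> as any feasible allocation. Let \<open>t\<close> be the last step that picks a
  valuation below \<open>c\<close> (\<open>t = 0\<close> if there is none). After step \<open>t\<close> all valuations \<open>\<ge> c\<close> in tiers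
  \<open>\<le> t\<close> are assigned, and all items of tiers \<open>> t\<close> go to valuations \<open>\<ge> c\<close>; a feasible allocation
  cannot do better on either part. Dominance at all thresholds implies dominance of the sums.
\<close>

section \<open>Highest elements of a finite set, and sums compared through threshold counts\<close>

lemma ex_highest:
  fixes f :: "'a \<Rightarrow> real"
  assumes "finite S" "m \<le> card S"
  shows "\<exists>A. A \<subseteq> S \<and> card A = m \<and> finite A \<and> (\<forall>a \<in> A. \<forall>b \<in> S - A. f b \<le> f a)"
  using assms(2)
proof (induction m)
  case 0
  show ?case by (intro exI[of _ "{}"]) auto
next
  case (Suc m)
  then obtain A where A: "A \<subseteq> S" "card A = m" "finite A" "\<forall>a \<in> A. \<forall>b \<in> S - A. f b \<le> f a"
    by auto
  have "S - A \<noteq> {}"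
    using A Suc.prems by auto
  then have "Max (f ` (S - A)) \<in> f ` (S - A)"
    using assms(1) by (intro Max_in) auto
  then obtain x where x: "x \<in> S - A" "f x = Max (f ` (S - A))"
    by auto
  then have "\<forall>y \<in> S - A. f y \<le> f x"
    using assms(1) by simp
  \<comment> \<open>\<open>insert x A\<close> keeps the order: \<open>A\<close> dominates all of
    \<open>S - A\<close>, hence what remains of it, and \<open>x\<close> dominates the rest by
    maximality.\<close>
  with A x(1) show ?case
    by (intro exI[of _ "insert x A"]) auto
qed

lemma highest_properties:
  fixes f :: "'a \<Rightarrow> real"
  assumes "finite S" "m \<le> card S"
  shows "highest f m S \<subseteq> S" "card (highest f m S) = m" "finite (highest f m S)"
    and "\<lbrakk>a \<in> highest f m S; b \<in> S - highest f m S\<rbrakk> \<Longrightarrow> f b \<le> f a"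
  using someI_ex[OF ex_highest[OF assms, of f], folded highest_def] by blast+

text \<open>If a chosen \<open>a\<close> were nonpositive, no positive element could be left out, so
  the \<open>m\<close> or more positive ones together with \<open>a\<close> would exceed the
  \<open>m\<close> places.\<close>

lemma highest_positive:
  fixes f :: "'a \<Rightarrow> real"
  assumes "finite S" "m \<le> card {s \<in> S. f s > 0}" "a \<in> highest f m S"
  shows "f a > 0"
proof (rule ccontr)
  assume "\<not> f a > 0"
  have "m \<le> card S"
    using assms(1,2) card_mono[of S "{s \<in> S. f s > 0}"] by fastforce
  note H = highest_properties[OF assms(1) this, where f = f]
  have "{s \<in> S. f s > 0} \<subseteq> highest f m S - {a}"
    using H(4)[OF assms(3)] \<open>\<not> f a > 0\<close> by fastforce
  then have "card {s \<in> S. f s > 0} \<le> card (highest f m S - {a})"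
    using H(3) by (intro card_mono) auto
  also have "\<dots> < m"
    using H(2,3) assms(3) by (metis card_Diff1_less)
  finally show False
    using assms(2) by simp
qed

text \<open>The count at threshold \<open>f x\<close>, for \<open>x\<close> largest in
  \<open>X\<close>, yields a partner \<open>g\<close> in \<open>G\<close> with \<open>f x\<close>
  \<le> \<open>f g\<close>. Removing both preserves the hypothesis: for \<open>c\<close> \<le>
  \<open>f x\<close> both counts drop by one, and for larger \<open>c\<close> nothing in
  \<open>X\<close> is counted.\<close>

lemma sum_le_if_threshold_counts_le:
  fixes f :: "'a \<Rightarrow> real"
  assumes "finite X" "finite G" "\<And>g. g \<in> G \<Longrightarrow> 0 \<le> f g"
    and "\<And>c. 0 < c \<Longrightarrow> card {x \<in> X. c \<le> f x} \<le> card {g \<in> G. c \<le> f g}"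
  shows "sum f X \<le> sum f G"
  using assms
proof (induction X arbitrary: G rule: finite_ranking_induct[where f = f])
  case empty
  then show ?case by (simp add: sum_nonneg)
next
  case (insert x S)
  show ?case
  proof (cases "f x > 0")
    \<comment> \<open>The thresholds see only positive values. Here the maximum is nonpositive, so
      the signs of the two sums suffice.\<close>
    case False
    then have "sum f (insert x S) \<le> 0"
      using insert by (intro sum_nonpos) fastforce
    also have "0 \<le> sum f G"
      using insert by (intro sum_nonneg) auto
    finally show ?thesis .
  next
    case True
    have "x \<in> {y \<in> insert x S. f x \<le> f y}" by simp
    then have "card {y \<in> insert x S. f x \<le> f y} > 0"
      using insert by (subst card_gt_0_iff) auto
    with True "insert.prems"(3)[OF True] have "card {g \<in> G. f x \<le> f g} > 0"
      by linarith
    then obtain g where g: "g \<in> G" "f x \<le> f g"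
      by (auto simp: card_gt_0_iff)
    \<comment> \<open>The ranking induction does not guarantee that \<open>x\<close> is new to
      \<open>S\<close>.\<close>
    show ?thesis
    proof (cases "x \<in> S")
      case True
      then show ?thesis using insert by (simp add: insert_absorb)
    next
      case False
      have "sum f S \<le> sum f (G - {g})"
      proof (rule "insert.IH")
        fix c :: real assume c: "0 < c"
        show "card {y \<in> S. c \<le> f y} \<le> card {y \<in> G - {g}. c \<le> f y}"
        proof (cases "c \<le> f x")
          case True
          have "{y \<in> insert x S. c \<le> f y} = insert x {y \<in> S. c \<le> f y}"
            using True by auto
          then have "Suc (card {y \<in> S. c \<le> f y}) = card {y \<in> insert x S. c \<le> f y}"
            using False insert by simp
          also have "\<dots> \<le> card {y \<in> G. c \<le> f y}"
            using "insert.prems"(3) c by blast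
          also have "{y \<in> G. c \<le> f y} = insert g {y \<in> G - {g}. c \<le> f y}"
            using g True by auto
          also have "card \<dots> = Suc (card {y \<in> G - {g}. c \<le> f y})"
            using insert by simp
          finally show ?thesis by simp
        next
          case False
          then have "{y \<in> S. c \<le> f y} = {}"
            using insert by fastforce
          then show ?thesis by (simp only: card.empty)
        qed
      qed (use insert in auto)
      then show ?thesis
        using g False insert by (simp add: sum.remove[of G g])
    qed
  qed
qed

lemma card_prefixes:
  fixes x :: "nat \<Rightarrow> nat"
  assumes "finite I"
  shows "card (SIGMA i:I. {1..x i}) = (\<Sum>i\<in>I. x i)"
  using assms by simp

section \<open>Invariants of the greedy run\<close>

context tiered_instance
begin

abbreviation "assigned \<equiv> greedy_assigned L q n l u"
abbreviation "available t \<equiv> {(i, j) \<in> valuations L q n. l i \<le> t}"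
abbreviation "picked t \<equiv> highest (\<lambda>(i, j). u i j) (q (Suc t)) (available (Suc t) - assigned t)"

lemma finite_valuations: "finite (valuations L q n)"
  by (simp add: valuations_def)

lemma finite_available: "finite (available t)"
  by (rule finite_subset[OF _ finite_valuations]) auto

text \<open>Tiers up to \<open>Suc t\<close> hold at least \<open>total_supply (Suc t) q\<close>
  positive valuations, and the earlier steps have used up at most \<open>total_supply t q\<close> of
  them.\<close>

lemma card_positive_unassigned:
  assumes "t < L" "finite (assigned t)" "card (assigned t) = total_supply t q"
  shows "q (Suc t) \<le> card {s \<in> available (Suc t) - assigned t. (\<lambda>(i, j). u i j) s > 0}"
proof -
  let ?P = "{(i, j) \<in> valuations L q n. l i \<le> Suc t \<and> u i j > 0}"
  have "total_supply (Suc t) q \<le> card ?P"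
    using not_undersubscribed[of "Suc t"] assms(1) by simp
  moreover have "card ?P - card (assigned t) \<le> card (?P - assigned t)"
    using assms(2) by (rule diff_card_le_card_Diff)
  moreover have "?P - assigned t = {s \<in> available (Suc t) - assigned t. (\<lambda>(i, j). u i j) s > 0}"
    by auto
  ultimately show ?thesis
    using assms(3) by (simp add: total_supply_def)
qed

text \<open>Both claims go through one induction: the exact count so far guarantees enough positive
  valuations for the next step, which then picks only positive ones and fills its quota.\<close>

lemma assigned_invariant:
  assumes "t \<le> L"
  shows "assigned t \<subseteq> {(i, j) \<in> available t. u i j > 0} \<and> card (assigned t) = total_supply t q"
  using assms
proof (induction t)
  case 0
  show ?case by (simp add: total_supply_def)
next
  case (Suc t)
  then have IH: "assigned t \<subseteq> {(i, j) \<in> available t. u i j > 0}" "card (assigned t) = total_supply t q"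
    by auto
  have fin: "finite (assigned t)"
    by (rule finite_subset[OF _ finite_available[of t]]) (use IH in auto)
  have finS: "finite (available (Suc t) - assigned t)"
    using finite_available by blast
  have pos: "q (Suc t) \<le> card {s \<in> available (Suc t) - assigned t. (\<lambda>(i, j). u i j) s > 0}"
    using card_positive_unassigned Suc.prems fin IH(2) by simp
  then have "q (Suc t) \<le> card (available (Suc t) - assigned t)"
    by (rule order_trans) (use finS in \<open>auto intro!: card_mono\<close>)
  note H = highest_properties[OF finS this, where f = "\<lambda>(i, j). u i j"]
  have "card (assigned (Suc t)) = card (assigned t) + card (picked t)"
    using H(1,3) fin by (auto intro!: card_Un_disjoint)
  then have "card (assigned (Suc t)) = total_supply (Suc t) q"
    using IH(2) H(2) by (simp add: total_supply_def)
  moreover have "assigned (Suc t) \<subseteq> {(i, j) \<in> available (Suc t). u i j > 0}"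
    using IH(1) H(1) highest_positive[OF finS pos] by fastforce
  ultimately show ?case by blast
qed

lemma assigned_subset: "t \<le> L \<Longrightarrow> assigned t \<subseteq> available t"
  using assigned_invariant by fastforce

lemma assigned_positive: "\<lbrakk>t \<le> L; (i, j) \<in> assigned t\<rbrakk> \<Longrightarrow> u i j > 0"
  using assigned_invariant by fastforce

lemma card_assigned: "t \<le> L \<Longrightarrow> card (assigned t) = total_supply t q"
  using assigned_invariant by blast

lemma finite_assigned: "t \<le> L \<Longrightarrow> finite (assigned t)"
  using assigned_subset finite_available finite_subset by blast

lemma assigned_mono: "s \<le> t \<Longrightarrow> assigned s \<subseteq> assigned t"
  by (rule lift_Suc_mono_le[of assigned]) auto

lemma picked_ge:
  assumes "t < L" "(i, j) \<in> picked t" "(i', j') \<in> available (Suc t) - assigned (Suc t)"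
  shows "u i' j' \<le> u i j"
proof -
  let ?S = "available (Suc t) - assigned t"
  have finS: "finite ?S"
    using finite_available by blast
  have "q (Suc t) \<le> card {s \<in> ?S. (\<lambda>(i, j). u i j) s > 0}"
    using card_positive_unassigned finite_assigned card_assigned assms(1) by simp
  also have "\<dots> \<le> card ?S"
    using finS by (auto intro!: card_mono)
  finally show ?thesis
    using highest_properties(4)[OF finS, where m = "q (Suc t)" and a = "(i, j)" and b = "(i', j')"
        and f = "\<lambda>(i, j). u i j"] assms
    by auto
qed

text \<open>If \<open>(i, k)\<close> were left out when \<open>(i, j)\<close> is picked, greedy
  choice and monotonicity would force \<open>u i k = u i j\<close>. This value is positive, so
  distinctness gives \<open>k = j\<close>, a contradiction.\<close>

lemma assigned_downward_closed:
  assumes "t \<le> L" "(i, j) \<in> assigned t" "1 \<le> k" "k \<le> j"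
  shows "(i, k) \<in> assigned t"
  using assms(1,2)
proof (induction t)
  case 0
  then show ?case by simp
next
  case (Suc t)
  show ?case
  proof (cases "(i, j) \<in> assigned t")
    case True
    then show ?thesis using Suc by simp
  next
    case False
    then have picked: "(i, j) \<in> picked t"
      using Suc.prems by simp
    have "(i, j) \<in> available (Suc t)" and pos: "u i j > 0"
      using Suc.prems assigned_subset[of "Suc t"] assigned_positive[of "Suc t" i j] by auto
    then have ij: "i \<in> {1..n}" "j \<le> total_supply L q" "l i \<le> Suc t" "(i, j) \<in> valuations L q n"
      by (auto simp: valuations_def)
    then have ik: "(i, k) \<in> valuations L q n"
      using assms(3,4) by (auto simp: valuations_def)
    show ?thesis
    proof (rule ccontr)
      assume notin: "(i, k) \<notin> assigned (Suc t)"
      then have "u i k \<le> u i j"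
        using picked_ge[OF _ picked] ij ik Suc.prems(1) by simp
      then have "u i k = u i j"
        using decreasing[of i k j] ij assms(3,4) by fastforce
      then have "(i, k) = (i, j)"
        using inj_onD[OF distinct_positive, of "(i, k)" "(i, j)"] ij ik pos by simp
      then show False
        using notin Suc.prems by simp
    qed
  qed
qed

text \<open>By downward closure each bidder's assigned indices form an initial segment, so counting
  them loses nothing. Sums over the greedy allocation become statements about the set
  \<open>assigned L\<close>.\<close>

lemma assigned_eq_prefixes:
  "assigned L = (SIGMA i:{1..n}. {1..greedy_allocation L q n l u i})"
proof -
  have prefix: "{j. (i, j) \<in> assigned L} = {1..greedy_allocation L q n l u i}" for i
  proof -
    let ?J = "{j. (i, j) \<in> assigned L}"
    have sub: "?J \<subseteq> {1..total_supply L q}"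
      using assigned_subset[of L] by (auto simp: valuations_def)
    then have fin: "finite ?J"
      using finite_subset by blast
    show ?thesis
    proof (cases "?J = {}")
      case True
      then show ?thesis by (simp add: greedy_allocation_def)
    next
      case False
      then have "Max ?J \<in> ?J"
        using fin Max_in by blast
      then have "?J = {1..Max ?J}"
        using fin sub assigned_downward_closed[of L i "Max ?J"] by fastforce
      then show ?thesis
        unfolding greedy_allocation_def by (metis card_atLeastAtMost diff_Suc_1)
    qed
  qed
  have "assigned L \<subseteq> {1..n} \<times> UNIV"
    using assigned_subset[of L] by (auto simp: valuations_def)
  then show ?thesis
    using prefix by blast
qed

section \<open>Feasibility of the greedy allocation\<close>

lemma card_assigned_diff:
  assumes "t \<le> L"
  shows "card (assigned L - assigned t) = (\<Sum>k = Suc t..L. q k)"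
proof -
  have "card (assigned L - assigned t) = total_supply L q - total_supply t q"
    using card_Diff_subset[OF finite_assigned assigned_mono] card_assigned assms by simp
  also have "total_supply L q = total_supply t q + (\<Sum>k = Suc t..L. q k)"
    using assms sum.ub_add_nat[of 1 t q "L - t"] by (simp add: total_supply_def)
  finally show ?thesis by simp
qed

lemma feasible_greedy: "feasible L q n l (greedy_allocation L q n l u)"
  unfolding feasible_def
proof
  fix t assume "t \<in> {1..L}"
  then obtain s where s: "t = Suc s" "s < L"
    by (cases t) auto
  let ?I = "{i. i \<in> {1..n} \<and> t \<le> l i}"
  have "(\<Sum>i\<in>?I. greedy_allocation L q n l u i) = card (SIGMA i:?I. {1..greedy_allocation L q n l u i})"
    by (rule card_prefixes[symmetric]) simp
  also have "\<dots> \<le> card (assigned L - assigned s)"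
  proof (rule card_mono)
    show "finite (assigned L - assigned s)"
      using finite_assigned by blast
    show "(SIGMA i:?I. {1..greedy_allocation L q n l u i}) \<subseteq> assigned L - assigned s"
      unfolding assigned_eq_prefixes using assigned_subset[of s] s by fastforce
  qed
  also have "\<dots> = (\<Sum>k = t..L. q k)"
    using card_assigned_diff s by simp
  finally show "(\<Sum>i\<in>?I. greedy_allocation L q n l u i) \<le> (\<Sum>k = t..L. q k)" .
qed

section \<open>Optimality by thresholds\<close>

lemma last_step_below_threshold:
  fixes c :: real
  obtains t where "t \<le> L" "{(i, j) \<in> available t. c \<le> u i j} \<subseteq> assigned t"
    "assigned L - assigned t \<subseteq> {(i, j). c \<le> u i j}"
proof -
  \<comment> \<open>\<open>picked s\<close> is the choice made in step \<open>Suc s\<close>, so the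
    required \<open>t\<close> is \<open>Suc (Max ?T)\<close>, or 0 if \<open>?T\<close> is
    empty.\<close>
  let ?T = "{s. s < L \<and> (\<exists>i j. (i, j) \<in> picked s \<and> u i j < c)}"
  have above: "assigned T - assigned t \<subseteq> {(i, j). c \<le> u i j}"
    if "\<And>s. t \<le> s \<Longrightarrow> s \<notin> ?T" "T \<le> L" for t T
    using that(2)
  proof (induction T)
    case 0
    then show ?case by simp
  next
    case (Suc T)
    show ?case
    proof (cases "t \<le> T")
      case True
      then have "picked T \<subseteq> {(i, j). c \<le> u i j}"
        using that(1)[of T] Suc.prems by (auto simp: not_less)
      then show ?thesis
        using Suc by auto
    next
      case False
      then show ?thesis
        using assigned_mono[of "Suc T" t] by (auto simp del: greedy_assigned.simps)
    qed
  qed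
  show thesis
  proof (cases "?T = {}")
    case True
    \<comment> \<open>Tiers start at 1, so with \<open>t = 0\<close> there is nothing that must
      already be assigned.\<close>
    have "available 0 = {}"
      using tier by (fastforce simp: valuations_def)
    then show thesis
      using that[of 0] above[of 0 L] True by blast
  next
    case False
    have fin: "finite ?T" by simp
    define s where "s = Max ?T"
    have "s \<in> ?T"
      unfolding s_def using fin False by (rule Max_in)
    then obtain i j where ij: "s < L" "(i, j) \<in> picked s" "u i j < c"
      by blast
    have "s' \<notin> ?T" if "Suc s \<le> s'" for s'
      using that Max_ge[OF fin, of s'] unfolding s_def by (meson not_less_eq_eq)
    then have "assigned L - assigned (Suc s) \<subseteq> {(i, j). c \<le> u i j}"
      using above[of "Suc s" L] by blast
    \<comment> \<open>An available valuation \<ge> \<open>c\<close> left out here would exceed the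
      picked \<open>u i j < c\<close>.\<close>
    moreover have "{(i, j) \<in> available (Suc s). c \<le> u i j} \<subseteq> assigned (Suc s)"
      using picked_ge[OF ij(1,2)] ij(3) by force
    ultimately show thesis
      using that[of "Suc s"] ij(1) by simp
  qed
qed

text \<open>The constraint at tier 1 bounds the total number of items, so no feasible
  \<open>x\<close> reaches beyond the indices on which \<open>u\<close> is constrained.\<close>

lemma feasible_prefixes_subset:
  assumes "feasible L q n l x"
  shows "(SIGMA i:{1..n}. {1..x i}) \<subseteq> valuations L q n"
proof -
  have "x i \<le> total_supply L q" if i: "i \<in> {1..n}" for i
  proof -
    have "{i. i \<in> {1..n} \<and> 1 \<le> l i} = {1..n}" "1 \<in> {1..L}"
      using tier i by fastforce+
    then have "(\<Sum>i = 1..n. x i) \<le> total_supply L q"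
      using assms unfolding feasible_def total_supply_def by metis
    moreover have "x i \<le> (\<Sum>i = 1..n. x i)"
      using i by (intro member_le_sum) auto
    ultimately show ?thesis by simp
  qed
  then show ?thesis
    by (fastforce simp: valuations_def)
qed

lemma threshold_count_le:
  assumes "feasible L q n l x"
  shows "card {(i, j) \<in> SIGMA i:{1..n}. {1..x i}. c \<le> u i j} \<le> card {(i, j) \<in> assigned L. c \<le> u i j}"
proof -
  obtain t where t: "t \<le> L" "{(i, j) \<in> available t. c \<le> u i j} \<subseteq> assigned t"
    "assigned L - assigned t \<subseteq> {(i, j). c \<le> u i j}"
    by (rule last_step_below_threshold)
  let ?H = "{(i, j) \<in> available t. c \<le> u i j}"
  let ?I = "{i. i \<in> {1..n} \<and> Suc t \<le> l i}"
  let ?R = "SIGMA i:?I. {1..x i}"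
  have finH: "finite ?H"
    by (rule finite_subset[OF _ finite_available[of t]]) auto
  have "card ?R \<le> (\<Sum>k = Suc t..L. q k)"
  proof (cases "t < L")
    case True
    then have "(\<Sum>i\<in>?I. x i) \<le> (\<Sum>k = Suc t..L. q k)"
      using assms by (simp add: feasible_def)
    then show ?thesis
      using card_prefixes[of ?I x] by simp
  next
    \<comment> \<open>Now \<open>t = L\<close>: feasibility has no constraint at
      \<open>Suc t\<close>, but no bidder has such a tier.\<close>
    case False
    then have "?I = {}"
      using tier by fastforce
    then show ?thesis by (metis Sigma_empty1 card.empty le0)
  qed
  \<comment> \<open>Split by tier: a counted valuation in a tier \<le> \<open>t\<close> lies in
    \<open>?H\<close>, any other in \<open>?R\<close>.\<close>
  have "card {(i, j) \<in> SIGMA i:{1..n}. {1..x i}. c \<le> u i j} \<le> card (?H \<union> ?R)"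
  proof (rule card_mono)
    show "finite (?H \<union> ?R)"
      using finH by simp
    show "{(i, j) \<in> SIGMA i:{1..n}. {1..x i}. c \<le> u i j} \<subseteq> ?H \<union> ?R"
      using subsetD[OF feasible_prefixes_subset[OF assms]] by force
  qed
  also have "\<dots> \<le> card ?H + card ?R"
    by (rule card_Un_le)
  also have "\<dots> \<le> card ?H + card (assigned L - assigned t)"
    using \<open>card ?R \<le> _\<close> card_assigned_diff t(1) by simp
  \<comment> \<open>The union is disjoint because \<open>?H\<close> is contained in
    \<open>assigned t\<close>.\<close>
  also have "\<dots> = card (?H \<union> (assigned L - assigned t))"
    using t(2) finH finite_assigned by (intro card_Un_disjoint[symmetric]) auto
  also have "\<dots> \<le> card {(i, j) \<in> assigned L. c \<le> u i j}"
  proof (rule card_mono)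
    show "finite {(i, j) \<in> assigned L. c \<le> u i j}"
      by (rule finite_subset[OF _ finite_assigned[of L]]) auto
    show "?H \<union> (assigned L - assigned t) \<subseteq> {(i, j) \<in> assigned L. c \<le> u i j}"
      using t(2,3) assigned_mono[OF t(1)] by blast
  qed
  finally show ?thesis .
qed

lemma welfare_eq_sum_prefixes:
  "welfare n u x = sum (\<lambda>(i, j). u i j) (SIGMA i:{1..n}. {1..x i})"
  unfolding welfare_def by (rule sum.Sigma) auto

lemma welfare_le_greedy:
  assumes "feasible L q n l x"
  shows "welfare n u x \<le> welfare n u (greedy_allocation L q n l u)"
  \<comment> \<open>Both welfares become sums of valuations over index sets, the greedy one over
    \<open>assigned L\<close>, where threshold counts can be compared.\<close>
  unfolding welfare_eq_sum_prefixes assigned_eq_prefixes[symmetric]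
proof (rule sum_le_if_threshold_counts_le)
  show "finite (assigned L)"
    using finite_assigned by simp
  show "0 \<le> (case g of (i, j) \<Rightarrow> u i j)" if "g \<in> assigned L" for g
    using that assigned_positive[of L] by (cases g) (simp add: less_imp_le)
  show "card {g \<in> SIGMA i:{1..n}. {1..x i}. c \<le> (case g of (i, j) \<Rightarrow> u i j)}
      \<le> card {g \<in> assigned L. c \<le> (case g of (i, j) \<Rightarrow> u i j)}" for c
  proof -
    have "{g \<in> A. c \<le> (case g of (i, j) \<Rightarrow> u i j)} = {(i, j) \<in> A. c \<le> u i j}" for A
      by auto
    then show ?thesis
      using threshold_count_le[OF assms] by simp
  qed
qed simp

end

theorem theorem3:
  fixes L n :: nat
    and q l :: "nat \<Rightarrow> nat"
    and u :: "nat \<Rightarrow> nat \<Rightarrow> real"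
  assumes "tiered_instance L q n l u"
  shows "feasible L q n l (greedy_allocation L q n l u) \<and>
    (\<forall>x. feasible L q n l x \<longrightarrow> welfare n u x \<le> welfare n u (greedy_allocation L q n l u))"
  using tiered_instance.feasible_greedy[OF assms] tiered_instance.welfare_le_greedy[OF assms]
  by blast

end
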